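(* Let $R$ be a commutative ring. For any ideal $J$ of $R$, the $J$-basically full operation $L\subseteq M\mapsto L^{J\mathrm{bf}}_M:=(JL:_MJ)$ on pairs of $R$-modules is a hereditary closure operation.
   Context: For $R$-modules $L\subseteq M$ and an ideal $J$, $(L:_MJ)=\{z\in M\mid Jz\subseteq L\}$, and the $J$-basically full closure of $L$ in $M$ is $L^{J\mathrm{bf}}_M:=(JL:_MJ)$. A closure operation assigns to each pair $L\subseteq M$ of $R$-modules a submodule $L^{\mathrm{cl}}_M\subseteq M$, compatibly with isomorphisms of $M$, such that $L\subseteq L^{\mathrm{cl}}_M$; $L^{\mathrm{cl}}_M\subseteq N^{\mathrm{cl}}_M$ for $L\subseteq N\subseteq M$; and $(L^{\mathrm{cl}}_M)^{\mathrm{cl}}_M=L^{\mathrm{cl}}_M$. It is hereditary if $L^{\mathrm{cl}}_N=L^{\mathrm{cl}}_M\cap N$ for all $L\subseteq N\subseteq M$. *)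

theory Defs
  imports "HOL-Algebra.Module" "HOL-Algebra.Ideal"
begin

text \<open>The product \<open>JL\<close>, that is, the set of finite sums of elements \<open>j \<odot> x\<close>; compare \<open>ideal_prod\<close>. For an ideal
  \<open>J\<close> and a submodule \<open>L\<close> it contains zero because \<open>J\<close> and \<open>L\<close> are nonempty.\<close>

inductive_set ideal_smult :: "[('a, 'b, 'm) module_scheme, 'a set, 'b set] \<Rightarrow> 'b set"
  for M and J and L where
    smult: "\<lbrakk> j \<in> J; x \<in> L \<rbrakk> \<Longrightarrow> j \<odot>\<^bsub>M\<^esub> x \<in> ideal_smult M J L"
  | sum: "\<lbrakk> s \<in> ideal_smult M J L; t \<in> ideal_smult M J L \<rbrakk> \<Longrightarrow> s \<oplus>\<^bsub>M\<^esub> t \<in> ideal_smult M J L"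

definition module_colon :: "[('a, 'b, 'm) module_scheme, 'b set, 'a set] \<Rightarrow> 'b set"
  where "module_colon M L J = {z \<in> carrier M. \<forall>j\<in>J. j \<odot>\<^bsub>M\<^esub> z \<in> L}"

definition basically_full :: "['a set, ('a, 'b, 'm) module_scheme, 'b set] \<Rightarrow> 'b set"
  where "basically_full J M L = module_colon M (ideal_smult M J L) J"

definition module_iso ::
    "[('a, 'r) ring_scheme, ('a, 'b, 'm) module_scheme, ('a, 'c, 'n) module_scheme] \<Rightarrow> ('b \<Rightarrow> 'c) set"
  where "module_iso R M M' = {h \<in> iso (add_monoid M) (add_monoid M').
    \<forall>r\<in>carrier R. \<forall>x\<in>carrier M. h (r \<odot>\<^bsub>M\<^esub> x) = r \<odot>\<^bsub>M'\<^esub> h x}"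

text \<open>An operation on pairs \<open>L \<subseteq> M\<close> is a function of the module \<open>M\<close> and of the underlying set of \<open>L\<close>.
  Inside a formula, all modules have elements of one type. As a definable operation such as
  \<^const>\<open>basically_full\<close> is polymorphic in that type, compatibility with isomorphisms relates two
  functions \<open>cl\<close>, \<open>cl'\<close>, which are meant to be two type instances of the same operation.\<close>

definition iso_compatible ::
    "[('a, 'r) ring_scheme, ('a, 'b, 'm) module_scheme \<Rightarrow> 'b set \<Rightarrow> 'b set,
      ('a, 'c, 'n) module_scheme \<Rightarrow> 'c set \<Rightarrow> 'c set] \<Rightarrow> bool"
  where "iso_compatible R cl cl' \<longleftrightarrow>
    (\<forall>M M' h L. module R M \<longrightarrow> module R M' \<longrightarrow> h \<in> module_iso R M M' \<longrightarrow> submodule L R M \<longrightarrow>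
      h ` cl M L = cl' M' (h ` L))"

locale closure_operation =
  fixes R :: "('a, 'r) ring_scheme"
    and cl :: "('a, 'b, 'm) module_scheme \<Rightarrow> 'b set \<Rightarrow> 'b set"
  assumes submodule: "\<lbrakk> module R M; submodule L R M \<rbrakk> \<Longrightarrow> submodule (cl M L) R M"
    and iso_compatible: "iso_compatible R cl cl"
    and extensive: "\<lbrakk> module R M; submodule L R M \<rbrakk> \<Longrightarrow> L \<subseteq> cl M L"
    and mono: "\<lbrakk> module R M; submodule L R M; submodule N R M; L \<subseteq> N \<rbrakk> \<Longrightarrow> cl M L \<subseteq> cl M N"
    and idem: "\<lbrakk> module R M; submodule L R M \<rbrakk> \<Longrightarrow> cl M (cl M L) = cl M L"

locale hereditary_closure_operation = closure_operation +
  assumes hereditary: "\<lbrakk> module R M; submodule L R M; submodule N R M; L \<subseteq> N \<rbrakk> \<Longrightarrow>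
    cl (M\<lparr>carrier := N\<rparr>) L = cl M L \<inter> N"

end

(* Idempotence reduces to J L' = J L for L' = (J L : J): by definition J L' \<subseteq> J L, and L \<subseteq> L' gives
   the converse. Heredity holds because J L does not depend on the ambient module. *)

theory Submission
  imports Defs
begin

context module
begin

lemma submoduleI_smult:
  assumes "L \<subseteq> carrier M" "\<zero>\<^bsub>M\<^esub> \<in> L"
    and "\<And>x y. \<lbrakk> x \<in> L; y \<in> L \<rbrakk> \<Longrightarrow> x \<oplus>\<^bsub>M\<^esub> y \<in> L"
    and smult: "\<And>r x. \<lbrakk> r \<in> carrier R; x \<in> L \<rbrakk> \<Longrightarrow> r \<odot>\<^bsub>M\<^esub> x \<in> L"
  shows "submodule L R M"
proof (rule submoduleI)
  show "\<ominus>\<^bsub>M\<^esub> x \<in> L" if "x \<in> L" for x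
    using smult[of "\<ominus> \<one>" x] that assms(1) smult_l_minus[of \<one> x] by auto
qed (use assms in auto)

lemma ideal_smult_closed:
  assumes "J \<subseteq> carrier R" "L \<subseteq> carrier M" "z \<in> ideal_smult M J L"
  shows "z \<in> carrier M"
  using assms(3) by induction (use assms in auto)

lemma submodule_ideal_smult:
  assumes "ideal J R" "submodule L R M"
  shows "submodule (ideal_smult M J L) R M"
proof (rule submoduleI_smult)
  interpret J: ideal J R by fact
  interpret L: submodule L R M by fact
  have J: "J \<subseteq> carrier R" and L: "L \<subseteq> carrier M"
    using J.a_subset submoduleE(1)[OF assms(2)] by auto
  show "ideal_smult M J L \<subseteq> carrier M"
    using ideal_smult_closed[OF J L] by auto
  \<comment> \<open>The inductive set has no rule for the empty sum, so zero is produced as a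
    generator, the product of the zeros of \<open>J\<close> and \<open>L\<close>. A submodule is a
    subgroup of the additive monoid, hence \<open>L.one_closed\<close> speaks of zero.\<close>
  have "\<zero> \<odot>\<^bsub>M\<^esub> \<zero>\<^bsub>M\<^esub> \<in> ideal_smult M J L"
    using L.one_closed by (intro ideal_smult.smult) auto
  then show "\<zero>\<^bsub>M\<^esub> \<in> ideal_smult M J L"
    by simp
  show "r \<odot>\<^bsub>M\<^esub> z \<in> ideal_smult M J L" if "r \<in> carrier R" "z \<in> ideal_smult M J L" for r z
    using that(2)
  proof induction
    case (smult j x)
    then show ?case
      \<comment> \<open>The scalar is absorbed by the ideal: \<open>r(jx) = (rj)x\<close> with
        \<open>rj\<close> in \<open>J\<close>, so the multiple of a generator is again a
        generator.\<close>
      using that(1) J L J.I_l_closed smult_assoc1[of r j x]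
      by (metis ideal_smult.smult subsetD)
  next
    case (sum s t)
    then show ?case
      using that(1) ideal_smult_closed[OF J L] by (simp add: smult_r_distr ideal_smult.sum)
  qed
qed (rule ideal_smult.sum)

lemma submodule_module_colon:
  assumes "ideal J R" "submodule L R M"
  shows "submodule (module_colon M L J) R M"
proof (rule submoduleI_smult)
  interpret J: ideal J R by fact
  have J: "J \<subseteq> carrier R"
    using J.a_subset .
  note L = submoduleE[OF assms(2)] subgroup.one_closed[OF submodule.axioms(1)[OF assms(2)], simplified]
  show "module_colon M L J \<subseteq> carrier M" "\<zero>\<^bsub>M\<^esub> \<in> module_colon M L J"
    using J L by (auto simp: module_colon_def subset_iff)
  show "x \<oplus>\<^bsub>M\<^esub> y \<in> module_colon M L J"
    if "x \<in> module_colon M L J" "y \<in> module_colon M L J" for x y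
    using that J L by (auto simp: module_colon_def smult_r_distr subset_iff)
  show "r \<odot>\<^bsub>M\<^esub> x \<in> module_colon M L J"
    if "r \<in> carrier R" "x \<in> module_colon M L J" for r x
    \<comment> \<open>Here \<open>j(rx) = (jr)x\<close> with \<open>jr\<close> in \<open>J\<close>,
      so the colon condition on \<open>x\<close> at \<open>jr\<close> gives the one on
      \<open>rx\<close> at \<open>j\<close>.\<close>
    using that J L J.I_r_closed by (auto simp: module_colon_def subset_iff simp flip: smult_assoc1)
qed

lemma subset_basically_full: "L \<subseteq> carrier M \<Longrightarrow> L \<subseteq> basically_full J M L"
  by (auto simp: basically_full_def module_colon_def intro: ideal_smult.smult)

lemma submodule_basically_full:
  "\<lbrakk> ideal J R; submodule L R M \<rbrakk> \<Longrightarrow> submodule (basically_full J M L) R M"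
  by (simp add: basically_full_def submodule_module_colon submodule_ideal_smult)

lemma ideal_smult_basically_full:
  assumes "ideal J R" "submodule L R M"
  shows "ideal_smult M J (basically_full J M L) = ideal_smult M J L" (is "?l = ?r")
proof
  show "?l \<subseteq> ?r"
  proof
    fix z assume "z \<in> ?l"
    then show "z \<in> ?r"
      by induction (auto simp: basically_full_def module_colon_def intro: ideal_smult.sum)
  qed
  show "?r \<subseteq> ?l"
  proof
    fix z assume "z \<in> ?r"
    then show "z \<in> ?l"
      using subset_basically_full[of L J] submoduleE(1)[OF assms(2)]
      by induction (auto intro: ideal_smult.intros)
  qed
qed

end

lemma ideal_smult_mono:
  assumes "L \<subseteq> N"
  shows "ideal_smult M J L \<subseteq> ideal_smult M J N"
proof
  fix z assume "z \<in> ideal_smult M J L"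
  then show "z \<in> ideal_smult M J N"
    using assms by induction (auto intro: ideal_smult.intros)
qed

lemma basically_full_mono: "L \<subseteq> N \<Longrightarrow> basically_full J M L \<subseteq> basically_full J M N"
  using ideal_smult_mono[of L N M J] by (auto simp: basically_full_def module_colon_def)

text \<open>The product is generated by addition and scalar multiplication alone, and changing the
  carrier leaves both operations as they are.\<close>

lemma ideal_smult_carrier_update: "ideal_smult (M\<lparr>carrier := N\<rparr>) J L = ideal_smult M J L" (is "?l = ?r")
proof
  show "?l \<subseteq> ?r"
  proof
    fix z assume "z \<in> ?l"
    then show "z \<in> ?r"
      by induction (auto intro: ideal_smult.intros)
  qed
  show "?r \<subseteq> ?l"
  proof
    fix z assume "z \<in> ?r"
    then show "z \<in> ?l"
      \<comment> \<open>Instantiating the rules at the updated record lets simplification turn their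
        operations into those of \<open>M\<close>, as they occur in the induction.\<close>
      using ideal_smult.intros[where M = "M\<lparr>carrier := N\<rparr>" and J = J and L = L]
      by induction auto
  qed
qed

text \<open>This is heredity. Both colons test \<open>z\<close> against the same product
  \<open>JL\<close>; only the range of \<open>z\<close> differs, being \<open>N\<close> on the left
  and \<open>carrier M\<close> on the right before intersecting.\<close>

lemma basically_full_carrier_update:
  "N \<subseteq> carrier M \<Longrightarrow> basically_full J (M\<lparr>carrier := N\<rparr>) L = basically_full J M L \<inter> N"
  by (auto simp: basically_full_def module_colon_def ideal_smult_carrier_update)

lemma module_isoD:
  assumes "h \<in> module_iso R M M'"
  shows "bij_betw h (carrier M) (carrier M')"
    and "\<lbrakk> x \<in> carrier M; y \<in> carrier M \<rbrakk> \<Longrightarrow> h (x \<oplus>\<^bsub>M\<^esub> y) = h x \<oplus>\<^bsub>M'\<^esub> h y"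
    and "\<lbrakk> r \<in> carrier R; x \<in> carrier M \<rbrakk> \<Longrightarrow> h (r \<odot>\<^bsub>M\<^esub> x) = r \<odot>\<^bsub>M'\<^esub> h x"
  using assms by (auto simp: module_iso_def iso_def hom_def)

text \<open>Linearity of \<open>h\<close> matches the generators \<open>jx\<close> and
  \<open>j(h x)\<close>. One induction pushes sums forward, the other builds preimages of sums by
  adding preimages of the summands.\<close>

lemma image_ideal_smult:
  assumes "module R M" "h \<in> module_iso R M M'" and J: "J \<subseteq> carrier R" and L: "L \<subseteq> carrier M"
  shows "h ` ideal_smult M J L = ideal_smult M' J (h ` L)"
proof (intro equalityI image_subsetI subsetI)
  interpret module R M by fact
  note h = module_isoD[OF assms(2)]
  show "h z \<in> ideal_smult M' J (h ` L)" if "z \<in> ideal_smult M J L" for z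
    using that
  proof induction
    case (smult j x)
    then show ?case
      using h(3)[of j x] J L by (auto simp: subset_iff intro: ideal_smult.smult)
  next
    case (sum s t)
    then show ?case
      using h(2)[of s t] ideal_smult_closed[OF J L] by (auto intro: ideal_smult.sum)
  qed
  show "w \<in> h ` ideal_smult M J L" if "w \<in> ideal_smult M' J (h ` L)" for w
    using that
  proof induction
    case (smult j y)
    then obtain x where "x \<in> L" "y = h x"
      by auto
    then show ?case
      using smult h(3)[of j x] J L by (metis ideal_smult.smult imageI subsetD)
  next
    case (sum s t)
    then obtain x y where "x \<in> ideal_smult M J L" "y \<in> ideal_smult M J L" "s = h x" "t = h y"
      by auto
    then show ?case
      using h(2)[of x y] ideal_smult_closed[OF J L] by (metis ideal_smult.sum imageI)
  qed
qed

text \<open>By surjectivity every candidate in \<open>M'\<close> has the form \<open>h z\<close>. As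
  \<open>j(h z) = h(jz)\<close>, injectivity of \<open>h\<close> on the carrier pulls membership in
  the image of \<open>L\<close> back to \<open>jz\<close> in \<open>L\<close>.\<close>

lemma image_module_colon:
  assumes "module R M" "h \<in> module_iso R M M'" and J: "J \<subseteq> carrier R" and L: "L \<subseteq> carrier M"
  shows "h ` module_colon M L J = module_colon M' (h ` L) J"
proof -
  interpret module R M by fact
  note h = module_isoD[OF assms(2)]
  have inj: "inj_on h (carrier M)" and surj: "h ` carrier M = carrier M'"
    using h(1) by (auto simp: bij_betw_def)
  have "j \<odot>\<^bsub>M'\<^esub> h z \<in> h ` L \<longleftrightarrow> j \<odot>\<^bsub>M\<^esub> z \<in> L" if "j \<in> J" "z \<in> carrier M" for j z
    using that h(3)[of j z] J L inj_on_image_mem_iff[OF inj, of "j \<odot>\<^bsub>M\<^esub> z" L] by auto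
  then show ?thesis
    by (auto simp: module_colon_def simp flip: surj)
qed

text \<open>The isomorphism passes first through the outer colon, applied to \<open>JL\<close>, and
  then through the product. The element types of \<open>M\<close> and \<open>M'\<close> are
  independent, so the result serves both the closure axiom and the second conjunct of the
  theorem.\<close>

lemma iso_compatible_basically_full:
  assumes "ideal J R"
  shows "iso_compatible R (basically_full J) (basically_full J)"
  unfolding iso_compatible_def
proof (intro allI impI)
  fix M :: "('a, 'c, 'd) module_scheme" and M' :: "('a, 'e, 'f) module_scheme" and h L
  assume M: "module R M" and h: "h \<in> module_iso R M M'" and L: "submodule L R M"
  interpret J: ideal J R by fact
  have "J \<subseteq> carrier R"
    using J.a_subset .
  moreover have "L \<subseteq> carrier M" "ideal_smult M J L \<subseteq> carrier M"
    using module.submoduleE(1)[OF M] module.submodule_ideal_smult[OF M assms] L by auto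
  ultimately show "h ` basically_full J M L = basically_full J M' (h ` L)"
    using M h by (simp add: basically_full_def image_module_colon image_ideal_smult)
qed

theorem proposition7p3:
  fixes R :: "('a, 'r) ring_scheme" and J :: "'a set"
  assumes "cring R" and "ideal J R"
  shows "hereditary_closure_operation R
           (basically_full J :: ('a, 'b, 'm) module_scheme \<Rightarrow> 'b set \<Rightarrow> 'b set)
       \<and> iso_compatible R
           (basically_full J :: ('a, 'b, 'm) module_scheme \<Rightarrow> 'b set \<Rightarrow> 'b set)
           (basically_full J :: ('a, 'c, 'n) module_scheme \<Rightarrow> 'c set \<Rightarrow> 'c set)"
proof
  show "hereditary_closure_operation R
    (basically_full J :: ('a, 'b, 'm) module_scheme \<Rightarrow> 'b set \<Rightarrow> 'b set)"
  proof (intro hereditary_closure_operation.intro closure_operation.intro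
      hereditary_closure_operation_axioms.intro)
    fix M :: "('a, 'b, 'm) module_scheme" and L N :: "'b set"
    assume "module R M" and L: "submodule L R M"
    interpret module R M by fact
    show "submodule (basically_full J M L) R M"
      using assms(2) L by (rule submodule_basically_full)
    show "L \<subseteq> basically_full J M L"
      using submoduleE(1)[OF L] by (rule subset_basically_full)
    show "basically_full J M (basically_full J M L) = basically_full J M L"
      \<comment> \<open>The closure depends on \<open>L\<close> only through \<open>JL\<close>, so
        equal products give equal closures.\<close>
      using ideal_smult_basically_full[OF assms(2) L] by (simp add: basically_full_def)
    show "basically_full J M L \<subseteq> basically_full J M N" if "L \<subseteq> N"
      using that by (rule basically_full_mono)
    show "basically_full J (M\<lparr>carrier := N\<rparr>) L = basically_full J M L \<inter> N" if "submodule N R M"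
      using submoduleE(1)[OF that] by (rule basically_full_carrier_update)
  qed (rule iso_compatible_basically_full[OF assms(2)])
qed (rule iso_compatible_basically_full[OF assms(2)])

end
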